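(* Let $X$ be a complex Banach space, let $\alpha\in\mathbb{C}$, and let $T$ be a bounded linear operator on $X$ with $\Vert T\Vert<1$. (i) The operator $(I-T)^\alpha$ is a bounded linear operator on $X$. (ii) The entire group $(e^{-t(I-T)^\alpha})_{t\in\mathbb{C}}$ satisfies $$e^{-t(I-T)^\alpha}=e^{-t}\sum_{n=0}^\infty p_{n;\alpha}(t)T^n,\qquad t\in\mathbb{C}.$$
   Context: The Cesàro numbers are $k^\alpha(0)=1$, $k^\alpha(n)=\frac{\alpha(\alpha+1)\cdots(\alpha+n-1)}{n!}$ for $n\ge1$, $\alpha\in\mathbb{C}$. The fractional power is $(I-T)^\alpha:=\sum_{n=0}^\infty k^{-\alpha}(n)T^n$, with $T^0=I$. For a bounded operator $A$, $e^A=\sum_{j\ge0}A^j/j!$. The falling factorial is $(z)_n=z(z-1)\cdots(z-n+1)$ for $n\ge1$. For $a\in\mathbb{C}$, the array $(b_{j,n;a})_{n\ge1,\,1\le j\le n}$ is defined by $b_{1,n;a}=(a)_n$, $b_{n,n;a}=a^n$ for $n\ge1$, and $b_{j,n+1;a}=(aj-n)b_{j,n;a}+a\,b_{j-1,n;a}$ for $2\le j\le n$. The polynomials $p_{n;a}$ are $p_{0;a}(t)=1$ and $p_{n;a}(t)=\frac{(-1)^n}{n!}\sum_{l=1}^n b_{l,n;a}(-t)^l$ for $n\ge1$. *)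

theory Defs
  imports "HOL-Analysis.Analysis"
begin

class scaleC =
  fixes scaleC :: "complex \<Rightarrow> 'a \<Rightarrow> 'a"  (infixr "*\<^sub>C" 75)

class complex_normed_vector = real_normed_vector + scaleC +
  assumes scaleC_add_right: "a *\<^sub>C (x + y) = a *\<^sub>C x + a *\<^sub>C y"
    and scaleC_add_left: "(a + b) *\<^sub>C x = a *\<^sub>C x + b *\<^sub>C x"
    and scaleC_scaleC: "a *\<^sub>C (b *\<^sub>C x) = (a * b) *\<^sub>C x"
    and scaleR_scaleC: "r *\<^sub>R x = complex_of_real r *\<^sub>C x"
    and norm_scaleC: "norm (a *\<^sub>C x) = cmod a * norm x"

class complex_banach = complex_normed_vector + banach

instantiation complex :: complex_banach
begin

definition scaleC_complex :: "complex \<Rightarrow> complex \<Rightarrow> complex"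
  where "scaleC_complex a z = a * z"

instance
  by standard
    (simp_all add: scaleC_complex_def algebra_simps norm_mult scaleR_conv_of_real)

end

lemma bounded_linear_scaleC_right:
  "bounded_linear (\<lambda>x::'a::complex_normed_vector. a *\<^sub>C x)"
proof (rule bounded_linear_intro[where K = "cmod a"])
  show "a *\<^sub>C (r *\<^sub>R x) = r *\<^sub>R (a *\<^sub>C x)" for r and x :: 'a
    by (simp add: scaleR_scaleC scaleC_scaleC mult.commute)
qed (simp_all add: scaleC_add_right norm_scaleC mult.commute)

lemma norm_blinfun_le_scaled:
  fixes f g :: "'a::real_normed_vector \<Rightarrow>\<^sub>L 'b::real_normed_vector"
  assumes "\<And>x. norm (g x) = c * norm (f x)" and "0 \<le> c"
  shows "norm g \<le> c * norm f"
proof (rule norm_blinfun_bound)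
  show "norm (g x) \<le> c * norm f * norm x" for x
    using mult_left_mono[OF norm_blinfun[of f x] assms(2)] assms(1)
    by (simp add: mult.assoc)
qed (simp add: assms(2))

instantiation blinfun :: (real_normed_vector, complex_normed_vector) complex_normed_vector
begin

lift_definition scaleC_blinfun :: "complex \<Rightarrow> ('a \<Rightarrow>\<^sub>L 'b) \<Rightarrow> ('a \<Rightarrow>\<^sub>L 'b)"
  is "\<lambda>a f x. a *\<^sub>C f x"
  by (rule bounded_linear_compose[OF bounded_linear_scaleC_right])

instance
proof
  fix a b :: complex and r :: real and f g :: "'a \<Rightarrow>\<^sub>L 'b"
  show "a *\<^sub>C (f + g) = a *\<^sub>C f + a *\<^sub>C g"
    by transfer (simp add: scaleC_add_right)
  show "(a + b) *\<^sub>C f = a *\<^sub>C f + b *\<^sub>C f"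
    by transfer (simp add: scaleC_add_left)
  show 1: "a *\<^sub>C (b *\<^sub>C f) = (a * b) *\<^sub>C f" for a b and f :: "'a \<Rightarrow>\<^sub>L 'b"
    by transfer (simp add: scaleC_scaleC)
  show 2: "r *\<^sub>R f = complex_of_real r *\<^sub>C f" for r and f :: "'a \<Rightarrow>\<^sub>L 'b"
    by transfer (simp add: scaleR_scaleC)
  have le: "norm (a *\<^sub>C f) \<le> cmod a * norm f" for a and f :: "'a \<Rightarrow>\<^sub>L 'b"
    by (rule norm_blinfun_le_scaled) (simp_all add: scaleC_blinfun.rep_eq norm_scaleC)
  show "norm (a *\<^sub>C f) = cmod a * norm f"
  proof (cases "a = 0")
    case True
    then show ?thesis using le[of a f] by simp
  next
    case False
    have "f = inverse a *\<^sub>C (a *\<^sub>C f)"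
      using False 2[of 1 f] by (simp add: 1)
    then have "norm f \<le> cmod (inverse a) * norm (a *\<^sub>C f)"
      using le[of "inverse a" "a *\<^sub>C f"] by simp
    then have "cmod a * norm f \<le> norm (a *\<^sub>C f)"
      using False by (simp add: norm_inverse norm_divide field_simps)
    with le[of a f] show ?thesis by simp
  qed
qed

end

text \<open>
  Operators on a complex Banach space are elements of \<open>'a \<Rightarrow>\<^sub>L 'a\<close>, which carries the operator
  norm; that type only records real-linearity, so complex-linearity is expressed separately.
\<close>

definition bounded_clinear ::
  "('a::complex_normed_vector \<Rightarrow> 'b::complex_normed_vector) \<Rightarrow> bool"
  where "bounded_clinear f \<longleftrightarrow> bounded_linear f \<and> (\<forall>c x. f (c *\<^sub>C x) = c *\<^sub>C f x)"

definition blinfun_power ::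
  "('a::real_normed_vector \<Rightarrow>\<^sub>L 'a) \<Rightarrow> nat \<Rightarrow> ('a \<Rightarrow>\<^sub>L 'a)"
  where "blinfun_power A n = ((\<lambda>B. A o\<^sub>L B) ^^ n) id_blinfun"

text \<open>
  The library's \<open>exp\<close> is not available here, since \<open>'a \<Rightarrow>\<^sub>L 'a\<close> is not an instance of
  \<open>real_normed_algebra_1\<close>. The series below converges in operator norm.
\<close>

definition blinfun_exp :: "('a::banach \<Rightarrow>\<^sub>L 'a) \<Rightarrow> ('a \<Rightarrow>\<^sub>L 'a)"
  where "blinfun_exp A = (\<Sum>j. (1 / fact j) *\<^sub>R blinfun_power A j)"

definition cesaro :: "complex \<Rightarrow> nat \<Rightarrow> complex"
  where "cesaro \<alpha> n = pochhammer \<alpha> n / fact n"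

text \<open>\<open>id_minus_powr T \<alpha>\<close> is $(I-T)^\alpha$; the series is taken in operator norm.\<close>

definition id_minus_powr ::
  "('a::complex_banach \<Rightarrow>\<^sub>L 'a) \<Rightarrow> complex \<Rightarrow> ('a \<Rightarrow>\<^sub>L 'a)"
  where "id_minus_powr T \<alpha> = (\<Sum>n. cesaro (- \<alpha>) n *\<^sub>C blinfun_power T n)"

definition falling_fact :: "complex \<Rightarrow> nat \<Rightarrow> complex"
  where "falling_fact z n = (\<Prod>i<n. z - of_nat i)"

text \<open>
  \<open>b_array a j n\<close> is $b_{j,n;a}$; it is set to 0 outside the range \<open>1 \<le> j \<le> n\<close>.
\<close>

fun b_array :: "complex \<Rightarrow> nat \<Rightarrow> nat \<Rightarrow> complex" where
  "b_array a j 0 = 0"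
| "b_array a j (Suc n) =
    (if j = 1 then falling_fact a (Suc n)
     else if j = Suc n then a ^ Suc n
     else if 2 \<le> j \<and> j \<le> n
       then (a * of_nat j - of_nat n) * b_array a j n + a * b_array a (j - 1) n
     else 0)"

definition p_poly :: "complex \<Rightarrow> nat \<Rightarrow> complex \<Rightarrow> complex"
  where "p_poly a n t =
    (if n = 0 then 1
     else (- 1) ^ n / fact n * (\<Sum>l = 1..n. b_array a l n * (- t) ^ l))"

text \<open>
  A one-parameter group of bounded complex-linear operators, indexed by the complex plane, that
  is entire (complex differentiable everywhere) in operator norm.
\<close>

definition entire_group ::
  "(complex \<Rightarrow> ('a::complex_banach \<Rightarrow>\<^sub>L 'a)) \<Rightarrow> bool"
  where "entire_group E \<longleftrightarrow>
    (\<forall>t. bounded_clinear (blinfun_apply (E t))) \<and>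
    E 0 = id_blinfun \<and>
    (\<forall>s t. E (s + t) = E s o\<^sub>L E t) \<and>
    (\<forall>t. \<exists>D. (E has_derivative (\<lambda>h. h *\<^sub>C D)) (at t))"

end

theory Submission
  imports Defs
begin

text \<open>
  Write \<open>A\<close> for \<open>(I - T) ^ \<alpha>\<close> and \<open>s = - t\<close>. The exponential \<open>e^(sA)\<close> is a power series in \<open>A\<close>, and \<open>A\<close> is
  a power series in \<open>T\<close>; the formula for \<open>e^(sA)\<close> is what one obtains by substituting one series in
  the other and collecting powers of \<open>T\<close>. Two facts make this work.

  The first is analytic. If a formal power series \<open>F\<close> converges absolutely with weight \<open>r = norm B\<close>, it
  can be evaluated at the operator \<open>B\<close>, and this evaluation turns products of series into
  compositions of operators (\<open>op_eval_mult\<close>). The weighted sum of the absolute values of the coefficients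
  is submultiplicative, so the coefficients of \<open>F ^ j\<close> are controlled by the \<open>j\<close>-th power of
  that sum. This makes the double series behind a substitution absolutely convergent, so that
  its columns may be summed first (\<open>op_eval_op_eval\<close>). The same calculus, applied to the exponential series
  and \<open>A\<close>, gives the group law; the quadratic bound on the tail of the exponential
  series gives the complex derivative at the origin, which the group law moves to every other
  point.

  The second is a scalar identity. By the Vandermonde convolution the \<open>j\<close>-th power of the Newton
  series of \<open>(1 - z) ^ \<alpha>\<close> is the Newton series of \<open>(1 - z) ^ (\<alpha> j)\<close>, so the coefficient of \<open>T ^ n\<close> in
  \<open>e^(sA)\<close> is, up to the factor \<open>(- 1) ^ n / n!\<close>, the sum over \<open>j\<close> of \<open>s ^ j / j!\<close> times the falling
  factorial of \<open>\<alpha> j\<close> of length \<open>n\<close>. The recurrence of the array \<open>b\<close> says exactly that its entries are the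
  connection coefficients expanding this falling factorial of \<open>\<alpha> x\<close> in the falling
  factorials of \<open>x\<close> (\<open>falling_fact_mult\<close>). A falling factorial of \<open>j\<close> of length \<open>l\<close>, summed against \<open>s ^ j / j!\<close>,
  gives \<open>s ^ l e^s\<close>, in the manner of Dobinski's formula (\<open>exp_falling_fact_sums\<close>). What
  remains is \<open>e^s\<close> times the polynomial \<open>p\<close> (\<open>exp_newton_coeff_sums\<close>).
\<close>

section \<open>Scalar multiplication and complex-linear operators\<close>

lemma bounded_bilinear_scaleC:
  "bounded_bilinear (\<lambda>c (x::'a::complex_normed_vector). c *\<^sub>C x)"
proof
  fix r :: real and a :: complex and b :: 'a
  show "(r *\<^sub>R a) *\<^sub>C b = r *\<^sub>R (a *\<^sub>C b)"
    by (simp add: scaleR_scaleC[of r "a *\<^sub>C b"] scaleC_scaleC scaleR_conv_of_real)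
  show "a *\<^sub>C (r *\<^sub>R b) = r *\<^sub>R (a *\<^sub>C b)"
    by (simp add: scaleR_scaleC scaleC_scaleC mult.commute)
  show "\<exists>K. \<forall>a (b::'a). norm (a *\<^sub>C b) \<le> norm a * norm b * K"
    by (rule exI[of _ 1]) (simp add: norm_scaleC)
qed (simp_all add: scaleC_add_right scaleC_add_left)

interpretation scaleC: bounded_bilinear "\<lambda>c (x::'a::complex_normed_vector). c *\<^sub>C x"
  by (rule bounded_bilinear_scaleC)

lemma scaleC_one: "1 *\<^sub>C (x::'a::complex_normed_vector) = x"
  using scaleR_scaleC[of 1 x] by simp

lemma scaleC_apply: "blinfun_apply (c *\<^sub>C f) x = c *\<^sub>C blinfun_apply f x"
  by (simp add: scaleC_blinfun.rep_eq)

lemma compose_scaleC_left: "(c *\<^sub>C A) o\<^sub>L B = c *\<^sub>C (A o\<^sub>L B)"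
  by (rule blinfun_eqI) (simp add: scaleC_apply)

abbreviation clinear_op :: "('a::complex_normed_vector \<Rightarrow>\<^sub>L 'a) \<Rightarrow> bool"
  where "clinear_op A \<equiv> bounded_clinear (blinfun_apply A)"

lemma clinear_op_iff: "clinear_op A \<longleftrightarrow> (\<forall>c x. A (c *\<^sub>C x) = c *\<^sub>C A x)"
  by (simp add: bounded_clinear_def blinfun.bounded_linear_right)

lemma compose_scaleC_right: "clinear_op A \<Longrightarrow> A o\<^sub>L (c *\<^sub>C B) = c *\<^sub>C (A o\<^sub>L B)"
  by (rule blinfun_eqI) (simp add: scaleC_apply clinear_op_iff)

lemma clinear_op_scaleC: "clinear_op A \<Longrightarrow> clinear_op (c *\<^sub>C A)"
  by (simp add: clinear_op_iff scaleC_apply scaleC_scaleC mult.commute)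

lemma clinear_op_compose: "clinear_op A \<Longrightarrow> clinear_op B \<Longrightarrow> clinear_op (A o\<^sub>L B)"
  by (simp add: clinear_op_iff)

lemma clinear_op_id: "clinear_op id_blinfun"
  unfolding clinear_op_iff by simp

text \<open>
  Evaluation at a vector is continuous for the operator norm, so complex homogeneity passes to
  limits of series.
\<close>

lemma clinear_op_sums:
  assumes "f sums A" and "\<And>n. clinear_op (f n)"
  shows "clinear_op A"
  unfolding clinear_op_iff
proof (intro allI)
  fix c x
  have ev: "(\<lambda>n. f n y) sums A y" for y
    by (rule bounded_linear.sums[OF blinfun.bounded_linear_left assms(1)])
  have "(\<lambda>n. f n (c *\<^sub>C x)) sums (c *\<^sub>C A x)"
    using bounded_linear.sums[OF scaleC.bounded_linear_right ev, of c x] assms(2)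
    by (simp add: clinear_op_iff)
  with ev show "A (c *\<^sub>C x) = c *\<^sub>C A x" by (rule sums_unique2)
qed

lemma blinfun_power_0 [simp]: "blinfun_power A 0 = id_blinfun"
  and blinfun_power_Suc: "blinfun_power A (Suc n) = A o\<^sub>L blinfun_power A n"
  by (simp_all add: blinfun_power_def)

lemma compose_id_left [simp]: "id_blinfun o\<^sub>L A = A"
  and compose_id_right [simp]: "A o\<^sub>L id_blinfun = A"
  by (auto intro: blinfun_eqI)

lemma blinfun_power_add: "blinfun_power A (m + n) = blinfun_power A m o\<^sub>L blinfun_power A n"
  by (induction m) (auto simp: blinfun_power_Suc intro: blinfun_eqI)

lemma clinear_op_power: "clinear_op A \<Longrightarrow> clinear_op (blinfun_power A n)"
  by (induction n) (simp_all only: blinfun_power_0 blinfun_power_Suc clinear_op_id clinear_op_compose)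

lemma norm_blinfun_power_le: "norm (blinfun_power A n) \<le> norm A ^ n"
proof (induction n)
  case 0
  show ?case by (simp add: norm_blinfun_id_le)
next
  case (Suc n)
  show ?case
    using norm_blinfun_compose[of A "blinfun_power A n"] mult_left_mono[OF Suc norm_ge_zero[of A]]
    by (simp add: blinfun_power_Suc)
qed

lemma blinfun_power_scaleC:
  "clinear_op A \<Longrightarrow> blinfun_power (c *\<^sub>C A) n = c ^ n *\<^sub>C blinfun_power A n"
  by (induction n)
    (simp_all add: blinfun_power_Suc scaleC_one compose_scaleC_left compose_scaleC_right
      scaleC_scaleC)

section \<open>Absolutely convergent double series\<close>

text \<open>
  If the norms in each row are summable and the row totals are summable as well, the family is
  summable over all pairs, hence in any order. The unordered sum serves a rearrangement along
  diagonals (products), the column sums serve an interchange (substitutions).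
\<close>

lemma double_series_has_sum:
  fixes f :: "nat \<Rightarrow> nat \<Rightarrow> 'a::banach"
  assumes row: "\<And>i. summable (\<lambda>k. norm (f i k))"
    and rows: "summable (\<lambda>i. \<Sum>k. norm (f i k))"
  obtains S where "((\<lambda>(i, k). f i k) has_sum S) (UNIV \<times> UNIV)"
    and "(\<lambda>i. \<Sum>k. f i k) sums S" and "(\<lambda>k. \<Sum>i. f i k) sums S"
proof -
  let ?h = "\<lambda>(i, k). f i k"
  have hs: "((\<lambda>k. norm (f i k)) has_sum (\<Sum>k. norm (f i k))) UNIV" for i
    using row[of i] by (intro norm_summable_imp_has_sum) (auto simp: summable_sums)
  have abs: "(\<lambda>x. norm (?h x)) summable_on (UNIV \<times> UNIV)"
  proof (rule summable_on_SigmaI[where g = "\<lambda>i. \<Sum>k. norm (f i k)"])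
    show "(\<lambda>i. \<Sum>k. norm (f i k)) summable_on UNIV"
      using rows row by (intro norm_summable_imp_summable_on) (simp add: suminf_nonneg)
  qed (use hs in auto)
  then have "?h summable_on (UNIV \<times> UNIV)" by (rule abs_summable_summable)
  then obtain S where S: "(?h has_sum S) (UNIV \<times> UNIV)" by (auto simp: summable_on_def)
  have "((\<lambda>i. \<Sum>k. f i k) has_sum S) UNIV"
  proof (rule has_sum_SigmaD[OF S])
    show "((\<lambda>k. ?h (i, k)) has_sum (\<Sum>k. f i k)) UNIV" for i
      using row[of i] by (auto intro!: norm_summable_imp_has_sum summable_sums summable_norm_cancel)
  qed
  moreover have "((\<lambda>k. \<Sum>i. f i k) has_sum S) UNIV"
  proof (rule has_sum_SigmaD)
    show "((\<lambda>(k, i). f i k) has_sum S) (UNIV \<times> UNIV)"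
      using S has_sum_swap[of ?h UNIV UNIV S] by (simp add: case_prod_unfold)
    have "(\<lambda>(k, i). norm (f i k)) summable_on (UNIV \<times> UNIV)"
      using abs summable_on_swap[of "\<lambda>x. norm (?h x)" UNIV UNIV] by (simp add: case_prod_unfold)
    then have "(\<lambda>i. norm (f i k)) summable_on UNIV" for k
      by (rule summable_on_SigmaD1) simp
    then have col: "(\<lambda>i. f i k) summable_on UNIV" for k
      by (rule abs_summable_summable)
    show "((\<lambda>i. (\<lambda>(k, i). f i k) (k, i)) has_sum (\<Sum>i. f i k)) UNIV" for k
      using has_sum_infsum[OF col[of k]] sums_unique[OF has_sum_imp_sums[OF has_sum_infsum[OF col[of k]]]]
      by simp
  qed
  ultimately show ?thesis using S that has_sum_imp_sums by blast
qed

section \<open>Formal power series of an operator\<close>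

definition abs_conv :: "real \<Rightarrow> complex fps \<Rightarrow> bool"
  where "abs_conv r F \<longleftrightarrow> summable (\<lambda>n. norm (fps_nth F n) * r ^ n)"

text \<open>
  This is the norm of the weighted \<open>l\<^sup>1\<close> algebra of coefficient sequences. It majorises the
  operator norm of the value of the series at any operator of norm at most \<open>r\<close>.
\<close>

definition weighted_norm :: "real \<Rightarrow> complex fps \<Rightarrow> real"
  where "weighted_norm r F = (\<Sum>n. norm (fps_nth F n) * r ^ n)"

lemma weighted_norm_nonneg: "abs_conv r F \<Longrightarrow> 0 \<le> r \<Longrightarrow> 0 \<le> weighted_norm r F"
  unfolding abs_conv_def weighted_norm_def by (rule suminf_nonneg) simp_all

text \<open>
  The coefficients of a product are dominated by the Cauchy product of the two real series of
  absolute values, whose sum is the product of the two sums.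
\<close>

lemma abs_conv_mult:
  assumes "abs_conv r F" "abs_conv r G" and r: "0 \<le> r"
  shows "abs_conv r (F * G)" "weighted_norm r (F * G) \<le> weighted_norm r F * weighted_norm r G"
proof -
  let ?f = "\<lambda>n. norm (fps_nth F n) * r ^ n"
  let ?g = "\<lambda>n. norm (fps_nth G n) * r ^ n"
  have sums: "(\<lambda>n. \<Sum>i\<le>n. ?f i * ?g (n - i)) sums (weighted_norm r F * weighted_norm r G)"
    unfolding weighted_norm_def
    by (rule Cauchy_product_sums) (use assms in \<open>simp_all add: abs_conv_def\<close>)
  have le: "norm (fps_nth (F * G) n) * r ^ n \<le> (\<Sum>i\<le>n. ?f i * ?g (n - i))" for n
  proof -
    have "norm (fps_nth (F * G) n) \<le> (\<Sum>i\<le>n. norm (fps_nth F i) * norm (fps_nth G (n - i)))"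
      unfolding fps_mult_nth atLeast0AtMost by (rule order_trans[OF norm_sum]) (simp add: norm_mult)
    then have "norm (fps_nth (F * G) n) * r ^ n
        \<le> (\<Sum>i\<le>n. norm (fps_nth F i) * norm (fps_nth G (n - i))) * r ^ n"
      using r by (simp add: mult_right_mono)
    also have "\<dots> = (\<Sum>i\<le>n. ?f i * ?g (n - i))"
      unfolding sum_distrib_right
    proof (rule sum.cong)
      fix i assume "i \<in> {..n}"
      then have "r ^ n = r ^ i * r ^ (n - i)" by (simp flip: power_add)
      then show "norm (fps_nth F i) * norm (fps_nth G (n - i)) * r ^ n = ?f i * ?g (n - i)"
        by simp
    qed simp
    finally show ?thesis .
  qed
  show conv: "abs_conv r (F * G)"
    unfolding abs_conv_def
    by (rule summable_comparison_test'[OF sums_summable[OF sums], of 0]) (use le r in simp)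
  show "weighted_norm r (F * G) \<le> weighted_norm r F * weighted_norm r G"
    unfolding sums_unique[OF sums] unfolding weighted_norm_def
    by (rule suminf_le) (use le conv sums_summable[OF sums] in \<open>simp_all add: abs_conv_def\<close>)
qed

lemma abs_conv_power:
  assumes "abs_conv r F" and r: "0 \<le> r"
  shows "abs_conv r (F ^ j)" "weighted_norm r (F ^ j) \<le> weighted_norm r F ^ j"
proof -
  have one: "(\<lambda>n. norm (fps_nth (1 :: complex fps) n) * r ^ n) sums 1"
    using sums_single[of 0 "\<lambda>_. 1::real"] by (rule sums_cong[THEN iffD1, rotated]) auto
  have "abs_conv r (F ^ j) \<and> weighted_norm r (F ^ j) \<le> weighted_norm r F ^ j"
  proof (induction j)
    case 0
    show ?case using one by (simp add: abs_conv_def weighted_norm_def sums_iff)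
  next
    case (Suc j)
    then have "weighted_norm r F * weighted_norm r (F ^ j) \<le> weighted_norm r F * weighted_norm r F ^ j"
      using weighted_norm_nonneg[OF assms] by (intro mult_left_mono) auto
    with abs_conv_mult[OF assms(1) _ r, of "F ^ j"] Suc show ?case by auto
  qed
  then show "abs_conv r (F ^ j)" "weighted_norm r (F ^ j) \<le> weighted_norm r F ^ j" by auto
qed

definition op_eval :: "('a::complex_banach \<Rightarrow>\<^sub>L 'a) \<Rightarrow> complex fps \<Rightarrow> ('a \<Rightarrow>\<^sub>L 'a)"
  where "op_eval B F = (\<Sum>n. fps_nth F n *\<^sub>C blinfun_power B n)"

lemma norm_term_le: "norm (c *\<^sub>C blinfun_power B n) \<le> norm c * norm B ^ n"
  by (simp add: norm_scaleC mult_left_mono norm_blinfun_power_le)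

lemma op_eval_abs_summable:
  assumes "abs_conv (norm B) F"
  shows "summable (\<lambda>n. norm (fps_nth F n *\<^sub>C blinfun_power B n))"
  by (rule summable_comparison_test'[OF assms[unfolded abs_conv_def], of 0])
    (simp add: norm_term_le)

lemma op_eval_sums:
  fixes B :: "'a::complex_banach \<Rightarrow>\<^sub>L 'a"
  assumes "abs_conv (norm B) F"
  shows "(\<lambda>n. fps_nth F n *\<^sub>C blinfun_power B n) sums op_eval B F"
  unfolding op_eval_def
  by (rule summable_sums, rule summable_norm_cancel, rule op_eval_abs_summable[OF assms])

lemma clinear_op_eval:
  assumes "clinear_op B" "abs_conv (norm B) F"
  shows "clinear_op (op_eval B F)"
  by (rule clinear_op_sums[OF op_eval_sums[OF assms(2)]])
    (intro clinear_op_scaleC clinear_op_power assms(1))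

lemma op_eval_one: "op_eval B 1 = id_blinfun"
proof -
  have "(\<lambda>n. fps_nth 1 n *\<^sub>C blinfun_power B n) sums id_blinfun"
    using sums_single[of 0 "\<lambda>_. id_blinfun::'a \<Rightarrow>\<^sub>L 'a"]
    by (rule sums_cong[THEN iffD1, rotated]) (auto simp: scaleC_one scaleC.zero_left)
  then show ?thesis by (simp add: op_eval_def sums_iff)
qed

text \<open>
  The composition of the two operator series is a double series over pairs \<open>(i, k)\<close>. Summing it
  along the diagonals \<open>i + k = n\<close> collects the convolution of the coefficients in front of
  the \<open>n\<close>-th power; complex linearity of \<open>B\<close> is what lets the scalars of the second series
  pass through the powers of the first.
\<close>

lemma op_eval_mult:
  assumes B: "clinear_op B" and F: "abs_conv (norm B) F" and G: "abs_conv (norm B) G"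
  shows "op_eval B (F * G) = op_eval B F o\<^sub>L op_eval B G"
proof -
  define f where "f i = fps_nth F i *\<^sub>C blinfun_power B i" for i
  define g where "g i = fps_nth G i *\<^sub>C blinfun_power B i" for i
  have nf: "summable (\<lambda>i. norm (f i))" and ng: "summable (\<lambda>i. norm (g i))"
    unfolding f_def g_def using op_eval_abs_summable F G by blast+
  have row_le: "norm (f i o\<^sub>L g k) \<le> norm (f i) * norm (g k)" for i k
    by (rule norm_blinfun_compose)
  have row: "summable (\<lambda>k. norm (f i o\<^sub>L g k))" for i
    by (rule summable_comparison_test'[OF summable_mult[OF ng, of "norm (f i)"], of 0])
      (simp add: row_le)
  have rows: "summable (\<lambda>i. \<Sum>k. norm (f i o\<^sub>L g k))"
  proof (rule summable_comparison_test'[OF summable_mult2[OF nf, of "\<Sum>k. norm (g k)"], of 0])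
    fix i
    have "(\<Sum>k. norm (f i o\<^sub>L g k)) \<le> norm (f i) * (\<Sum>k. norm (g k))"
      unfolding suminf_mult[OF ng, symmetric]
      by (rule suminf_le[OF row_le row summable_mult[OF ng]])
    then show "norm (\<Sum>k. norm (f i o\<^sub>L g k)) \<le> norm (f i) * (\<Sum>k. norm (g k))"
      using row by (simp add: suminf_nonneg)
  qed
  obtain S where S: "((\<lambda>(i, k). f i o\<^sub>L g k) has_sum S) (UNIV \<times> UNIV)"
    and S1: "(\<lambda>i. \<Sum>k. f i o\<^sub>L g k) sums S"
    using double_series_has_sum[of "\<lambda>i k. f i o\<^sub>L g k", OF row rows] by blast
  have "(\<Sum>k. f i o\<^sub>L g k) = f i o\<^sub>L op_eval B G" for i
    using bounded_linear.sums[OF bounded_bilinear.bounded_linear_right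
        [OF bounded_bilinear_blinfun_compose] op_eval_sums[OF G], of "f i"]
    by (simp add: g_def sums_iff)
  moreover have "(\<lambda>i. f i o\<^sub>L op_eval B G) sums (op_eval B F o\<^sub>L op_eval B G)"
    unfolding f_def
    by (rule bounded_linear.sums[OF bounded_bilinear.bounded_linear_left
        [OF bounded_bilinear_blinfun_compose] op_eval_sums[OF F]])
  ultimately have S_eq: "S = op_eval B F o\<^sub>L op_eval B G"
    using S1 sums_unique2 by auto
  have bij: "bij_betw (\<lambda>(n, i). (i, n - i)) (SIGMA n:UNIV. {..n}) (UNIV \<times> (UNIV::nat set))"
    by (rule bij_betwI[where g = "\<lambda>(i, k). (i + k, i)"]) auto
  have "((\<lambda>x. case (case x of (n, i) \<Rightarrow> (i, n - i)) of (i, k) \<Rightarrow> f i o\<^sub>L g k) has_sum S)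
      (SIGMA n:UNIV. {..n})"
    using has_sum_reindex_bij_betw[OF bij] S by blast
  then have "((\<lambda>n. \<Sum>i\<le>n. f i o\<^sub>L g (n - i)) has_sum S) UNIV"
    by (rule has_sum_SigmaD) (auto intro!: has_sum_finiteI)
  moreover have "(\<Sum>i\<le>n. f i o\<^sub>L g (n - i)) = fps_nth (F * G) n *\<^sub>C blinfun_power B n" for n
  proof -
    have "f i o\<^sub>L g (n - i) = (fps_nth F i * fps_nth G (n - i)) *\<^sub>C blinfun_power B n"
      if "i \<le> n" for i
      using that blinfun_power_add[of B i "n - i"] clinear_op_power[OF B]
      by (simp add: f_def g_def compose_scaleC_left compose_scaleC_right scaleC_scaleC)
    then show ?thesis
      by (simp add: fps_mult_nth atLeast0AtMost scaleC.sum_left)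
  qed
  ultimately have "(\<lambda>n. fps_nth (F * G) n *\<^sub>C blinfun_power B n) sums S"
    using has_sum_imp_sums by auto
  then show ?thesis by (simp add: op_eval_def sums_iff S_eq)
qed

lemma blinfun_power_op_eval:
  assumes "clinear_op B" "abs_conv (norm B) F"
  shows "blinfun_power (op_eval B F) j = op_eval B (F ^ j)"
  by (induction j)
    (simp_all add: op_eval_one blinfun_power_Suc op_eval_mult abs_conv_power assms)

text \<open>
  Expanding each power of \<open>op_eval B F\<close> in powers of \<open>B\<close> gives a double series whose \<open>j\<close>-th row has total
  norm at most the \<open>j\<close>-th coefficient of \<open>G\<close> times \<open>weighted_norm (norm B) F ^ j\<close>. The
  convergence of \<open>G\<close> at that weight therefore allows summing over \<open>j\<close> first. The scalar sums \<open>c\<close> enter as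
  a hypothesis because they cannot be recovered from the operator series
  when a power of \<open>B\<close> vanishes.
\<close>

lemma op_eval_op_eval:
  assumes B: "clinear_op B" and F: "abs_conv (norm B) F"
    and G: "abs_conv (weighted_norm (norm B) F) G"
    and c: "\<And>n. (\<lambda>j. fps_nth G j * fps_nth (F ^ j) n) sums c n"
  shows "(\<lambda>n. c n *\<^sub>C blinfun_power B n) sums op_eval (op_eval B F) G"
proof -
  let ?w = "weighted_norm (norm B) F"
  define f where "f j n = (fps_nth G j * fps_nth (F ^ j) n) *\<^sub>C blinfun_power B n" for j n
  have Fj: "abs_conv (norm B) (F ^ j)" "weighted_norm (norm B) (F ^ j) \<le> ?w ^ j" for j
    using abs_conv_power[OF F] by auto
  have le: "norm (f j n) \<le> norm (fps_nth G j) * (norm (fps_nth (F ^ j) n) * norm B ^ n)" for j n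
    using norm_term_le[of "fps_nth G j * fps_nth (F ^ j) n" B n]
    by (simp add: f_def norm_mult mult.assoc)
  have bound: "summable (\<lambda>n. norm (fps_nth G j) * (norm (fps_nth (F ^ j) n) * norm B ^ n))" for j
    using Fj(1)[of j] by (intro summable_mult) (simp add: abs_conv_def)
  have row: "summable (\<lambda>n. norm (f j n))" for j
    by (rule summable_comparison_test'[OF bound[of j], of 0]) (simp add: le)
  have rows: "summable (\<lambda>j. \<Sum>n. norm (f j n))"
  proof (rule summable_comparison_test'[OF G[unfolded abs_conv_def], of 0])
    fix j
    have "(\<Sum>n. norm (f j n)) \<le> norm (fps_nth G j) * weighted_norm (norm B) (F ^ j)"
      unfolding weighted_norm_def
      by (subst suminf_mult[symmetric], use Fj(1)[of j] in \<open>simp add: abs_conv_def\<close>)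
        (rule suminf_le[OF le row bound])
    also have "\<dots> \<le> norm (fps_nth G j) * ?w ^ j"
      using Fj(2) by (simp add: mult_left_mono)
    finally show "norm (\<Sum>n. norm (f j n)) \<le> norm (fps_nth G j) * ?w ^ j"
      using row by (simp add: suminf_nonneg)
  qed
  obtain S where S1: "(\<lambda>j. \<Sum>n. f j n) sums S" and S2: "(\<lambda>n. \<Sum>j. f j n) sums S"
    using double_series_has_sum[of f, OF row rows] by blast
  have f_eq: "f j n = fps_nth G j *\<^sub>C (fps_nth (F ^ j) n *\<^sub>C blinfun_power B n)" for j n
    by (simp add: f_def scaleC_scaleC)
  have "(\<Sum>n. f j n) = fps_nth G j *\<^sub>C blinfun_power (op_eval B F) j" for j
    using bounded_linear.sums[OF scaleC.bounded_linear_right op_eval_sums[OF Fj(1)],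
        of "fps_nth G j" j]
    by (simp add: f_eq sums_iff blinfun_power_op_eval[OF B F])
  with S1 have S_eq: "S = op_eval (op_eval B F) G"
    by (simp add: op_eval_def sums_iff)
  have "(\<lambda>j. f j n) sums (c n *\<^sub>C blinfun_power B n)" for n
    unfolding f_def by (rule bounded_linear.sums[OF scaleC.bounded_linear_left c])
  then have "(\<Sum>j. f j n) = c n *\<^sub>C blinfun_power B n" for n
    by (rule sums_unique[symmetric])
  with S2 S_eq show ?thesis by simp
qed

section \<open>The exponential group of a bounded operator\<close>

lemma abs_conv_exp: "abs_conv r (fps_exp s)"
proof -
  have "summable (\<lambda>n. (norm s * r) ^ n /\<^sub>R fact n)" by (rule summable_exp_generic)
  then show ?thesis
    by (simp add: abs_conv_def norm_divide norm_power power_mult_distrib field_simps)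
qed

lemma blinfun_exp_scaleC:
  assumes "clinear_op A"
  shows "blinfun_exp (s *\<^sub>C A) = op_eval A (fps_exp s)"
  unfolding blinfun_exp_def op_eval_def
  by (simp add: blinfun_power_scaleC assms scaleR_scaleC scaleC_scaleC)

text \<open>
  The tail from the second order on is dominated termwise by that of the real exponential at
  \<open>x = norm s * norm A\<close>, and \<open>exp x - 1 - x \<le> x\<^sup>2\<close> holds on the unit interval.
\<close>

lemma norm_exp_remainder_le:
  fixes A :: "'a::complex_banach \<Rightarrow>\<^sub>L 'a"
  assumes s: "norm s * norm A \<le> 1"
  shows "norm (op_eval A (fps_exp s) - id_blinfun - s *\<^sub>C A) \<le> (norm s * norm A)\<^sup>2"
proof -
  let ?x = "norm s * norm A"
  let ?f = "\<lambda>n. fps_nth (fps_exp s) n *\<^sub>C blinfun_power A n"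
  have "?f sums op_eval A (fps_exp s)" by (rule op_eval_sums[OF abs_conv_exp])
  then have sm: "(\<lambda>n. ?f (n + 2)) sums (op_eval A (fps_exp s) - (\<Sum>i<2. ?f i))"
    by (rule sums_split_initial_segment)
  have ex: "(\<lambda>n. ?x ^ (n + 2) /\<^sub>R fact (n + 2)) sums (exp ?x - (\<Sum>i<2. ?x ^ i /\<^sub>R fact i))"
    by (rule sums_split_initial_segment[OF exp_converges])
  have le: "norm (?f n) \<le> ?x ^ n /\<^sub>R fact n" for n
    using norm_term_le[of "fps_nth (fps_exp s) n" A n]
    by (simp add: norm_divide norm_power norm_mult power_mult_distrib field_simps)
  have "norm (op_eval A (fps_exp s) - (\<Sum>i<2. ?f i)) \<le> exp ?x - (\<Sum>i<2. ?x ^ i /\<^sub>R fact i)"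
    unfolding sums_unique[OF sm] sums_unique[OF ex]
    by (rule norm_suminf_le[OF le sums_summable[OF ex]])
  also have "\<dots> \<le> ?x\<^sup>2"
    using exp_bound[of ?x] s by (simp add: numeral_2_eq_2)
  also have "(\<Sum>i<2. ?f i) = id_blinfun + s *\<^sub>C A"
    by (simp add: numeral_2_eq_2 blinfun_power_Suc scaleC_one)
  finally show ?thesis by (simp add: algebra_simps)
qed

lemma has_derivative_exp_at_0:
  fixes A :: "'a::complex_banach \<Rightarrow>\<^sub>L 'a"
  shows "((\<lambda>s. op_eval A (fps_exp s)) has_derivative (\<lambda>h. h *\<^sub>C A)) (at 0)"
  unfolding has_derivative_at
proof
  show "bounded_linear (\<lambda>h. h *\<^sub>C A)" by (rule scaleC.bounded_linear_left)
  let ?q = "\<lambda>h. norm (op_eval A (fps_exp (0 + h)) - op_eval A (fps_exp 0) - h *\<^sub>C A) / norm h"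
  show "?q \<midarrow>0\<rightarrow> 0"
  proof (rule Lim_null_comparison)
    have "((\<lambda>h::complex. norm h * norm A) \<longlongrightarrow> 0 * norm A) (at 0)"
      by (intro tendsto_intros tendsto_norm_zero)
    then have "eventually (\<lambda>h::complex. norm h * norm A < 1) (at 0)"
      by (rule order_tendstoD) simp
    then show "eventually (\<lambda>h. norm (?q h) \<le> norm h * (norm A)\<^sup>2) (at 0)"
    proof eventually_elim
      case (elim h)
      then show ?case
        using norm_exp_remainder_le[of h A]
        by (cases "h = 0") (simp_all add: op_eval_one field_simps power2_eq_square)
    qed
    have "((\<lambda>h::complex. norm h * (norm A)\<^sup>2) \<longlongrightarrow> 0 * (norm A)\<^sup>2) (at 0)"
      by (intro tendsto_intros tendsto_norm_zero)
    then show "((\<lambda>h::complex. norm h * (norm A)\<^sup>2) \<longlongrightarrow> 0) (at 0)" by simp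
  qed
qed

text \<open>
  Differentiability at \<open>t\<close> comes from differentiability at the origin, by writing the value at \<open>u\<close> as the
  value at \<open>t\<close> composed with the value at \<open>u - t\<close>.
\<close>

lemma entire_group_exp:
  fixes A :: "'a::complex_banach \<Rightarrow>\<^sub>L 'a"
  assumes A: "clinear_op A"
  shows "entire_group (\<lambda>t. blinfun_exp ((- t) *\<^sub>C A))"
proof -
  define E where "E s = op_eval A (fps_exp s)" for s
  have E_lin: "clinear_op (E s)" for s
    unfolding E_def by (rule clinear_op_eval[OF A abs_conv_exp])
  have E_add: "E (s + t) = E s o\<^sub>L E t" for s t
    unfolding E_def fps_exp_add_mult by (rule op_eval_mult[OF A abs_conv_exp abs_conv_exp])
  have "\<exists>D. ((\<lambda>t. E (- t)) has_derivative (\<lambda>h. h *\<^sub>C D)) (at t)" for t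
  proof -
    have "((\<lambda>u. t - u) has_derivative (\<lambda>h. - h)) (at t)"
      by (auto intro!: derivative_eq_intros)
    moreover have "(E has_derivative (\<lambda>h. h *\<^sub>C A)) (at (t - t))"
      unfolding E_def using has_derivative_exp_at_0 by simp
    ultimately have "((\<lambda>u. E (t - u)) has_derivative (\<lambda>h. (- h) *\<^sub>C A)) (at t)"
      using has_derivative_compose by blast
    then have "((\<lambda>u. E (- t) o\<^sub>L E (t - u)) has_derivative (\<lambda>h. E (- t) o\<^sub>L ((- h) *\<^sub>C A))) (at t)"
      by (rule bounded_linear.has_derivative[OF bounded_bilinear.bounded_linear_right
            [OF bounded_bilinear_blinfun_compose]])
    moreover have "E (- t) o\<^sub>L E (t - u) = E (- u)" for u
      using E_add[of "- t" "t - u"] by simp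
    moreover have "E (- t) o\<^sub>L ((- h) *\<^sub>C A) = h *\<^sub>C (- (E (- t) o\<^sub>L A))" for h
      by (subst compose_scaleC_right[OF E_lin]) (simp add: scaleC.minus_left scaleC.minus_right)
    ultimately show ?thesis by auto
  qed
  moreover have "E 0 = id_blinfun" by (simp add: E_def op_eval_one)
  ultimately show ?thesis
    unfolding entire_group_def blinfun_exp_scaleC[OF A] E_def[symmetric]
    using E_lin E_add by (auto simp: add.commute E_add[symmetric])
qed

section \<open>Newton series of the fractional powers\<close>

text \<open>
  The expansion of \<open>(1 - z) ^ a\<close> at the origin.
\<close>

definition newton_fps :: "complex \<Rightarrow> complex fps"
  where "newton_fps a = Abs_fps (cesaro (- a))"

lemma newton_fps_nth [simp]: "fps_nth (newton_fps a) n = cesaro (- a) n"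
  by (simp add: newton_fps_def)

text \<open>
  This is the Vandermonde convolution for rising factorials, divided by \<open>n!\<close>.
\<close>

lemma newton_fps_add: "newton_fps (a + b) = newton_fps a * newton_fps b"
proof (rule fps_ext)
  fix n
  have "cesaro (- (a + b)) n
      = (\<Sum>k\<le>n. of_nat (n choose k) * pochhammer (- a) k * pochhammer (- b) (n - k)) / fact n"
    using pochhammer_binomial_sum[of "- a" "- b" n] by (simp add: cesaro_def)
  also have "\<dots> = (\<Sum>k\<le>n. cesaro (- a) k * cesaro (- b) (n - k))"
    unfolding sum_divide_distrib
    by (rule sum.cong) (auto simp: cesaro_def binomial_fact)
  finally show "fps_nth (newton_fps (a + b)) n = fps_nth (newton_fps a * newton_fps b) n"
    by (simp add: fps_mult_nth atLeast0AtMost)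
qed

lemma newton_fps_power: "newton_fps a ^ j = newton_fps (a * of_nat j)"
proof (induction j)
  case 0
  show ?case by (rule fps_ext) (simp add: cesaro_def pochhammer_0_left)
next
  case (Suc j)
  then show ?case using newton_fps_add[of a "a * of_nat j"] by (simp add: algebra_simps)
qed

text \<open>
  Up to sign the coefficients are the generalised binomial coefficients, whose series has radius
  of convergence at least 1.
\<close>

lemma abs_conv_newton:
  assumes "0 \<le> r" "r < 1"
  shows "abs_conv r (newton_fps a)"
proof -
  have "summable (\<lambda>n. norm ((a gchoose n) * complex_of_real r ^ n))"
    by (rule abs_summable_in_conv_radius) (use assms in \<open>simp add: conv_radius_gchoose\<close>)
  then show ?thesis
    using assms
    by (simp add: abs_conv_def cesaro_def gbinomial_pochhammer norm_mult norm_power norm_divide)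
qed

section \<open>Taylor coefficients of the exponentiated Newton series\<close>

lemma falling_fact_Suc: "falling_fact z (Suc n) = falling_fact z n * (z - of_nat n)"
  by (simp add: falling_fact_def)

lemma cesaro_uminus: "cesaro (- z) n = (- 1) ^ n / fact n * falling_fact z n"
proof -
  have "pochhammer (- z) n = (- 1) ^ n * falling_fact z n"
    by (induction n) (simp_all add: falling_fact_def pochhammer_rec' algebra_simps)
  then show ?thesis by (simp add: cesaro_def)
qed

text \<open>
  The terms with \<open>j < l\<close> vanish. In the others the falling factorial is \<open>j! / (j - l)!\<close>, so that shifting
  the index by \<open>l\<close> leaves \<open>s ^ l\<close> times the exponential series.
\<close>

lemma exp_falling_fact_sums:
  "(\<lambda>j. s ^ j / fact j * falling_fact (of_nat j) l) sums (s ^ l * exp s)"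
proof -
  have zero: "falling_fact (of_nat j) l = 0" if "j < l" for j
    using that unfolding falling_fact_def by (intro prod_zero) auto
  have shift: "falling_fact (of_nat (j + l)) l * fact j = fact (j + l)" for j
  proof (induction l)
    case (Suc l)
    have "falling_fact (of_nat (j + Suc l)) (Suc l)
        = of_nat (j + Suc l) * falling_fact (of_nat (j + l)) l"
      by (simp add: falling_fact_def prod.lessThan_Suc_shift del: prod.lessThan_Suc)
    with Suc show ?case by (simp add: mult.assoc)
  qed (simp add: falling_fact_def)
  have "s ^ (j + l) / fact (j + l) * falling_fact (of_nat (j + l)) l = s ^ l * (s ^ j /\<^sub>R fact j)" for j
  proof -
    have "falling_fact (of_nat (j + l)) l = fact (j + l) / fact j"
      using shift[of j] by (simp add: field_simps)
    then show ?thesis by (simp add: power_add scaleR_conv_of_real field_simps)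
  qed
  moreover have "(\<lambda>j. s ^ l * (s ^ j /\<^sub>R fact j)) sums (s ^ l * exp s)"
    by (intro sums_mult exp_converges)
  ultimately have "(\<lambda>j. s ^ (j + l) / fact (j + l) * falling_fact (of_nat (j + l)) l)
      sums (s ^ l * exp s)"
    by simp
  then show ?thesis by (subst (asm) sums_zero_iff_shift) (use zero in auto)
qed

lemma b_array_0: "b_array a 0 n = 0"
  by (cases n) auto

lemma b_array_above: "n < l \<Longrightarrow> b_array a l n = 0"
  by (cases n) auto

text \<open>
  With the value 0 outside the triangle, the interior recurrence also produces the prescribed
  first column and diagonal, so that it can be used uniformly in \<open>l\<close>. It starts at \<open>n = 1\<close>,
  since the row \<open>n = 0\<close> is entirely zero.
\<close>

lemma b_array_rec:
  assumes "1 \<le> n"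
  shows "b_array a (Suc l) (Suc n)
    = (a * of_nat (Suc l) - of_nat n) * b_array a (Suc l) n + a * b_array a l n"
proof -
  obtain m where n: "n = Suc m" using assms by (cases n) auto
  consider "l = 0" | "l = n" | "n < l" | "1 \<le> l" "l < n" by linarith
  then show ?thesis
  proof cases
    case 1
    then show ?thesis by (simp add: n falling_fact_Suc b_array_0 algebra_simps)
  next
    case 2
    then show ?thesis by (auto simp: n falling_fact_def)
  next
    case 3
    then show ?thesis by (simp add: b_array_above)
  next
    case 4
    then show ?thesis by simp
  qed
qed

text \<open>
  Passing from \<open>n\<close> to \<open>n + 1\<close> multiplies the left side by \<open>a x - n\<close>. On the falling factorial of
  length \<open>l\<close> this factor splits as \<open>(a l - n) + a (x - l)\<close>: the first part keeps the length and the
  second raises it to \<open>l + 1\<close>, which is the recurrence of the array.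
\<close>

lemma falling_fact_mult:
  assumes "1 \<le> n"
  shows "falling_fact (a * x) n = (\<Sum>l\<le>n. b_array a l n * falling_fact x l)"
  using assms
proof (induction n rule: dec_induct)
  case base
  show ?case by (simp add: falling_fact_def)
next
  case (step n)
  let ?b = "\<lambda>l. b_array a l n"
  let ?x = "falling_fact x"
  have "(\<Sum>l\<le>Suc n. b_array a l (Suc n) * ?x l)
      = (\<Sum>l\<le>n. b_array a (Suc l) (Suc n) * ?x (Suc l))"
    by (simp only: sum.atMost_Suc_shift b_array_0 mult_zero_left mult_zero_right add_0)
  also have "\<dots> = (\<Sum>l\<le>n. (a * of_nat (Suc l) - of_nat n) * ?b (Suc l) * ?x (Suc l))
      + (\<Sum>l\<le>n. a * ?b l * ?x (Suc l))"
    by (simp only: b_array_rec[OF step.hyps(1)] distrib_right sum.distrib)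
  also have "(\<Sum>l\<le>n. (a * of_nat (Suc l) - of_nat n) * ?b (Suc l) * ?x (Suc l))
      = (\<Sum>l\<le>Suc n. (a * of_nat l - of_nat n) * ?b l * ?x l)"
    by (simp only: sum.atMost_Suc_shift b_array_0 mult_zero_left mult_zero_right add_0)
  also have "\<dots> = (\<Sum>l\<le>n. (a * of_nat l - of_nat n) * ?b l * ?x l)"
    by (simp add: b_array_above)
  also have "\<dots> + (\<Sum>l\<le>n. a * ?b l * ?x (Suc l)) = (\<Sum>l\<le>n. ?b l * ?x l) * (a * x - of_nat n)"
    unfolding sum.distrib[symmetric] sum_distrib_right
    by (rule sum.cong) (simp_all add: falling_fact_Suc algebra_simps)
  also have "\<dots> = falling_fact (a * x) (Suc n)"
    by (simp only: step.IH falling_fact_Suc)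
  finally show ?case by simp
qed

text \<open>
  The \<open>n\<close>-th Taylor coefficient at the origin of \<open>exp (s (1 - z) ^ a)\<close>, computed by expanding the outer
  exponential.
\<close>

lemma exp_newton_coeff_sums:
  "(\<lambda>j. s ^ j / fact j * cesaro (- (a * of_nat j)) n) sums (exp s * p_poly a n (- s))"
proof (cases "n = 0")
  case True
  then show ?thesis using exp_falling_fact_sums[of s 0]
    by (simp add: cesaro_def p_poly_def falling_fact_def)
next
  case False
  let ?k = "(- 1) ^ n / fact n :: complex"
  have "(\<lambda>j. ?k * (\<Sum>l\<le>n. b_array a l n * (s ^ j / fact j * falling_fact (of_nat j) l)))
      sums (?k * (\<Sum>l\<le>n. b_array a l n * (s ^ l * exp s)))"
    by (intro sums_mult sums_sum exp_falling_fact_sums)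
  moreover have "?k * (\<Sum>l\<le>n. b_array a l n * (s ^ j / fact j * falling_fact (of_nat j) l))
      = s ^ j / fact j * cesaro (- (a * of_nat j)) n" for j
    using False by (simp add: cesaro_uminus falling_fact_mult sum_distrib_left mult_ac)
  moreover have "(\<Sum>l\<le>n. b_array a l n * (s ^ l * exp s))
      = exp s * (\<Sum>l = 1..n. b_array a l n * s ^ l)"
    by (simp add: sum_distrib_left mult_ac atMost_atLeast0 sum.atLeast_Suc_atMost b_array_0)
  ultimately show ?thesis using False by (simp add: p_poly_def mult_ac)
qed

section \<open>The exponential of a fractional power\<close>

theorem theorem5p2:
  fixes T :: "'a::complex_banach \<Rightarrow>\<^sub>L 'a" and \<alpha> :: complex
  assumes "bounded_clinear (blinfun_apply T)"
    and "norm T < 1"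
  shows "(summable (\<lambda>n. cesaro (- \<alpha>) n *\<^sub>C blinfun_power T n)
        \<and> bounded_clinear (blinfun_apply (id_minus_powr T \<alpha>)))
    \<and> (entire_group (\<lambda>t. blinfun_exp ((- t) *\<^sub>C id_minus_powr T \<alpha>))
      \<and> (\<forall>t::complex.
           summable (\<lambda>n. p_poly \<alpha> n t *\<^sub>C blinfun_power T n)
         \<and> blinfun_exp ((- t) *\<^sub>C id_minus_powr T \<alpha>)
             = exp (- t) *\<^sub>C (\<Sum>n. p_poly \<alpha> n t *\<^sub>C blinfun_power T n)))"
proof -
  define A where "A = id_minus_powr T \<alpha>"
  have conv: "abs_conv (norm T) (newton_fps \<alpha>)"
    using assms(2) by (simp add: abs_conv_newton)
  have A_eval: "A = op_eval T (newton_fps \<alpha>)"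
    by (simp add: A_def id_minus_powr_def op_eval_def)
  have A_summable: "summable (\<lambda>n. cesaro (- \<alpha>) n *\<^sub>C blinfun_power T n)"
    using sums_summable[OF op_eval_sums[OF conv]] by simp
  have A_lin: "clinear_op A"
    unfolding A_eval by (rule clinear_op_eval[OF assms(1) conv])
  have expansion: "summable (\<lambda>n. p_poly \<alpha> n t *\<^sub>C blinfun_power T n)
      \<and> blinfun_exp ((- t) *\<^sub>C A) = exp (- t) *\<^sub>C (\<Sum>n. p_poly \<alpha> n t *\<^sub>C blinfun_power T n)" for t
  proof -
    let ?p = "\<lambda>n. p_poly \<alpha> n t *\<^sub>C blinfun_power T n"
    have "(\<lambda>n. (exp (- t) * p_poly \<alpha> n t) *\<^sub>C blinfun_power T n)
        sums op_eval A (fps_exp (- t))"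
      unfolding A_eval
    proof (rule op_eval_op_eval[OF assms(1) conv abs_conv_exp])
      show "(\<lambda>j. fps_nth (fps_exp (- t)) j * fps_nth (newton_fps \<alpha> ^ j) n)
          sums (exp (- t) * p_poly \<alpha> n t)" for n
        using exp_newton_coeff_sums[of "- t" \<alpha> n] by (simp add: newton_fps_power)
    qed
    then have sums: "(\<lambda>n. exp (- t) *\<^sub>C ?p n) sums blinfun_exp ((- t) *\<^sub>C A)"
      by (simp add: scaleC_scaleC blinfun_exp_scaleC[OF A_lin])
    (* Multiplying back by exp t yields the summability of the polynomial series itself. *)
    have "(\<lambda>n. exp t *\<^sub>C (exp (- t) *\<^sub>C ?p n)) sums (exp t *\<^sub>C blinfun_exp ((- t) *\<^sub>C A))"
      by (rule bounded_linear.sums[OF scaleC.bounded_linear_right sums])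
    then have "?p sums (exp t *\<^sub>C blinfun_exp ((- t) *\<^sub>C A))"
      by (simp add: scaleC_scaleC exp_minus flip: mult.assoc)
    then show ?thesis
      by (simp add: sums_iff scaleC_scaleC exp_minus scaleC_one)
  qed
  show ?thesis
    using A_summable A_lin entire_group_exp[OF A_lin] expansion unfolding A_def by blast
qed

end
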